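(* Let $A$ be a Lebesgue measurable subset of $[0,1]$ that is 3-sum-free, i.e. there are no $x,y,z\in A$ (not necessarily distinct) with $x+y=3z$. Then $$\mu(A)\leq \frac{77}{177}.$$
   Context: $\mu$ denotes Lebesgue measure on $\mathbb{R}$. *)

theory Defs
  imports "HOL-Analysis.Analysis"
begin

definition three_sum_free :: "real set \<Rightarrow> bool" where
  "three_sum_free A \<longleftrightarrow> \<not> (\<exists>x\<in>A. \<exists>y\<in>A. \<exists>z\<in>A. x + y = 3 * z)"

end

(*
For compact X of diameter d, folding X + Y modulo d counts the translate of Y by the least element
of X twice, so Raikov's theorem on the circle of length d, i.e. the continuous Cauchy-Davenport
inequality, yields |X + Y| >= |Y| + min d (|X| + |Y|).

Let A be compact and 3-sum-free with least element m and greatest element b. Since (A + A)/3 avoids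
A, the sumset inequality shows that the top part C = A \<inter> [2b/3, b] has measure at least b/6, and
the sumsets (x + C)/3, (X + C)/3 and (C + C)/3 then fill almost everything between 2b/9 + m/3 and
2b/3. The holes of C are repaid exactly, so that |A| <= b/3 + |A \<inter> [m, 2b/9 + m/3]|. Two applications
of this inequality and a crude bound for the remaining lowest part give 77/177, which is attained
by the three intervals (8, 12), (28, 42), (118, 177) scaled by 1/177.
*)

theory Submission
  imports Defs "HOL-Number_Theory.Cong"
begin

subsection \<open>The Cauchy--Davenport inequality on the circle\<close>

text \<open>Induction on the size of \<open>B\<close> by Dyson's e-transform: shifted elements of
  \<open>B\<close> that miss \<open>A\<close> are moved from \<open>B\<close> to \<open>A\<close>.
  This keeps the total size, creates no new sums, and makes \<open>B\<close> strictly
  smaller.\<close>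

lemma cauchy_davenport:
  fixes A B :: "int set" and p :: int
  assumes p: "prime p" and A: "A \<subseteq> {0..<p}" "A \<noteq> {}" and B: "B \<subseteq> {0..<p}" "B \<noteq> {}"
  shows "min (nat p) (card A + card B - 1) \<le> card {(a + b) mod p | a b. a \<in> A \<and> b \<in> B}"
  using A B
proof (induction "card B" arbitrary: A B rule: less_induct)
  case less
  let ?S = "\<lambda>A B. {(a + b) mod p | a b. a \<in> A \<and> b \<in> B}"
  have p0: "p > 0" using p by (simp add: prime_gt_0_int)
  have fA: "finite A" and fB: "finite B" using less.prems finite_subset by blast+
  have SS: "?S A B \<subseteq> {0..<p}" using p0 by auto
  have fS: "finite (?S A B)" using SS finite_subset by blast
  have inj: "inj_on (\<lambda>b. (b + e) mod p) {0..<p}" for e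
  proof (rule inj_onI)
    fix x y assume "x \<in> {0..<p}" "y \<in> {0..<p}" "(x + e) mod p = (y + e) mod p"
    then have "[x + e = y + e] (mod p)" by (simp add: cong_def)
    then have "[x = y] (mod p)" using cong_add_rcancel by blast
    then show "x = y" using \<open>x \<in> _\<close> \<open>y \<in> _\<close> by (simp add: cong_def)
  qed
  obtain b0 where b0: "b0 \<in> B" using less.prems by blast
  have base: "card A \<le> card (?S A B)"
  proof -
    have "card ((\<lambda>a. (a + b0) mod p) ` A) = card A"
      using inj[of b0] less.prems(1) by (intro card_image) (rule inj_on_subset)
    moreover have "(\<lambda>a. (a + b0) mod p) ` A \<subseteq> ?S A B" using b0 by blast
    then have "card ((\<lambda>a. (a + b0) mod p) ` A) \<le> card (?S A B)" by (rule card_mono[OF fS])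
    ultimately show ?thesis by simp
  qed
  show ?case
  proof (cases "B = {b0} \<or> A = {0..<p}")
    case True
    then show ?thesis
    proof
      assume "B = {b0}" then show ?thesis using base by simp
    next
      assume "A = {0..<p}" then have "card A = nat p" by simp
      then show ?thesis using base by simp
    qed
  next
    case False
    then obtain b1 where b1: "b1 \<in> B" "b1 \<noteq> b0" using b0 by blast
    define g where "g = b1 - b0"
    have cop: "coprime g p"
    proof -
      have "\<not> p dvd g"
      proof
        assume "p dvd g"
        then have "[b1 = b0] (mod p)" by (simp add: g_def cong_iff_dvd_diff)
        moreover have "b0 \<in> {0..<p}" "b1 \<in> {0..<p}" using b0 b1 less.prems(3) by blast+
        ultimately show False using b1 by (simp add: cong_def)
      qed
      then show ?thesis using p prime_imp_coprime coprime_commute by blast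
    qed
    \<comment> \<open>The nonzero difference \<open>g\<close> generates the group, so a nonempty set
      closed under adding \<open>g\<close> would be everything, but \<open>A\<close> is
      proper.\<close>
    obtain a where a: "a \<in> A" "(a + g) mod p \<notin> A"
    proof (rule ccontr)
      assume "\<not> thesis"
      then have cl: "\<And>a. a \<in> A \<Longrightarrow> (a + g) mod p \<in> A" using that by blast
      obtain a where a: "a \<in> A" using less.prems by blast
      have it: "(a + int k * g) mod p \<in> A" for k
      proof (induction k)
        case 0
        then show ?case using a less.prems(1) by auto
      next
        case (Suc k)
        have "((a + int k * g) mod p + g) mod p = (a + int (Suc k) * g) mod p"
          by (simp add: mod_simps algebra_simps)
        then show ?case using cl[OF Suc] by simp
      qed
      have "{0..<p} \<subseteq> A"
      proof
        fix r assume r: "r \<in> {0..<p}"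
        obtain h where h: "[g * h = 1] (mod p)" using cong_solve_coprime_int[OF cop] by blast
        define k where "k = nat ((h * (r - a)) mod p)"
        have "int k = (h * (r - a)) mod p" using p0 by (simp add: k_def)
        then have "[int k = h * (r - a)] (mod p)" by (simp add: cong_def)
        then have "[a + int k * g = a + h * (r - a) * g] (mod p)"
          by (intro cong_add cong_mult) auto
        also have "a + h * (r - a) * g = a + (g * h) * (r - a)" by (simp add: algebra_simps)
        also have "[\<dots> = a + 1 * (r - a)] (mod p)" by (intro cong_add cong_mult h) auto
        finally have "(a + int k * g) mod p = r" using r by (simp add: cong_def)
        then show "r \<in> A" using it by metis
      qed
      then show False using False less.prems(1) by blast
    qed
    \<comment> \<open>This shift sends \<open>b0\<close> to \<open>a\<close>, inside
      \<open>A\<close>, and \<open>b1\<close> to \<open>a + g\<close>, outside \<open>A\<close>.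
      Hence \<open>B'\<close> keeps \<open>b0\<close> and loses \<open>b1\<close>.\<close>
    define e where "e = a - b0"
    define sh where "sh b = (b + e) mod p" for b
    have injB: "inj_on sh B" unfolding sh_def using inj less.prems(3) inj_on_subset by blast
    define B' where "B' = {b \<in> B. sh b \<in> A}"
    define A' where "A' = A \<union> sh ` B"
    have b0': "b0 \<in> B'" using b0 a less.prems(1) by (auto simp: B'_def sh_def e_def)
    have "sh b1 = (a + g) mod p" by (simp add: sh_def e_def g_def algebra_simps)
    then have b1': "b1 \<notin> B'" using a by (simp add: B'_def)
    have "B' \<subset> B" using b1 b1' by (auto simp: B'_def)
    then have lt: "card B' < card B" using fB psubset_card_mono by blast
    have "A' = A \<union> sh ` (B - B')" by (auto simp: A'_def B'_def)
    moreover have "A \<inter> sh ` (B - B') = {}" by (auto simp: B'_def)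
    ultimately have "card A' = card A + card (sh ` (B - B'))"
      using fA fB by (simp add: card_Un_disjoint)
    also have "card (sh ` (B - B')) = card (B - B')"
      by (rule card_image) (rule inj_on_subset[OF injB], blast)
    also have "\<dots> = card B - card B'" using fB by (intro card_Diff_subset) (auto simp: B'_def)
    finally have sum: "card A' + card B' = card A + card B" using lt by simp
    have "A' \<subseteq> {0..<p}" using less.prems(1) p0 by (auto simp: A'_def sh_def)
    moreover have "B' \<subseteq> {0..<p}" using less.prems(3) by (auto simp: B'_def)
    moreover have "A' \<noteq> {}" using less.prems by (auto simp: A'_def)
    ultimately have IH: "min (nat p) (card A' + card B' - 1) \<le> card (?S A' B')"
      using less.hyps[OF lt] b0' by blast
    have "?S A' B' \<subseteq> ?S A B"
    proof
      fix s assume "s \<in> ?S A' B'"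
      then obtain x y where xy: "x \<in> A'" "y \<in> B'" "s = (x + y) mod p" by blast
      show "s \<in> ?S A B"
      proof (cases "x \<in> A")
        case True
        then show ?thesis using xy by (auto simp: B'_def)
      next
        case False
        then obtain b where b: "b \<in> B" "x = sh b" using xy by (auto simp: A'_def)
        \<comment> \<open>The shift is passed from one summand to the other: (b + e) + y = b + (y +
          e).\<close>
        have "s = (sh y + b) mod p" using xy b by (simp add: sh_def mod_simps algebra_simps)
        moreover have "sh y \<in> A" using xy by (simp add: B'_def)
        ultimately show ?thesis using b by blast
      qed
    qed
    then have "card (?S A' B') \<le> card (?S A B)" using fS card_mono by blast
    then show ?thesis using IH sum by simp
  qed
qed

section \<open>Occupied cells and Lebesgue measure on the circle\<close>

lemma measure_le_card_cells:
  fixes X :: "real set"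
  assumes h: "0 < h" and X: "X \<in> lmeasurable" "X \<subseteq> {p..p + h * of_int n}"
  shows "measure lebesgue X \<le> h * card {i \<in> {0..<n}. \<exists>x\<in>X. p + h * of_int i \<le> x \<and> x < p + h * of_int i + h}"
    (is "_ \<le> h * card ?I")
proof -
  let ?c = "\<lambda>i. {p + h * of_int i ..< p + h * of_int i + h}"
  have fin: "finite ?I" by (rule finite_subset[of _ "{0..<n}"]) auto
  have cs: "?c i \<in> lmeasurable" for i
    using h by (intro fmeasurableI) auto
  \<comment> \<open>The right endpoint lies in none of the half-open cells; being a null set, it
    costs nothing.\<close>
  have "X \<subseteq> {p + h * of_int n} \<union> (\<Union>i\<in>?I. ?c i)"
  proof
    fix x assume x: "x \<in> X"
    show "x \<in> {p + h * of_int n} \<union> (\<Union>i\<in>?I. ?c i)"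
    proof (cases "x = p + h * of_int n")
      case False
      then have x': "p \<le> x" "x < p + h * of_int n" using X(2) x by force+
      define i where "i = \<lfloor>(x - p) / h\<rfloor>"
      have i1: "of_int i \<le> (x - p) / h" "(x - p) / h < of_int i + 1" by (auto simp: i_def)
      then have i2: "p + h * of_int i \<le> x" "x < p + h * of_int i + h"
        using h by (simp_all add: field_simps)
      have "0 \<le> (x - p) / h" "(x - p) / h < of_int n" using x' h by (simp_all add: field_simps)
      then have "i \<in> {0..<n}" by (simp add: i_def floor_less_iff)
      then have "i \<in> ?I" using i2 x by blast
      then show ?thesis using i2 by auto
    qed simp
  qed
  moreover have mU: "(\<Union>i\<in>?I. ?c i) \<in> lmeasurable" using cs fin by (intro fmeasurable.finite_UN) auto
  moreover have "{p + h * of_int n} \<union> (\<Union>i\<in>?I. ?c i) \<in> lmeasurable"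
    using fmeasurable.Un[OF lmeasurable_compact[OF compact_sing] mU] .
  ultimately have "measure lebesgue X \<le> measure lebesgue ({p + h * of_int n} \<union> (\<Union>i\<in>?I. ?c i))"
    using X(1) by (intro measure_mono_fmeasurable fmeasurableD)
  also have "\<dots> \<le> measure lebesgue {p + h * of_int n} + measure lebesgue (\<Union>i\<in>?I. ?c i)"
    using mU by (intro measure_Un_le) auto
  also have "\<dots> = measure lebesgue (\<Union>i\<in>?I. ?c i)" by simp
  also have "\<dots> \<le> (\<Sum>i\<in>?I. measure lebesgue (?c i))"
    using cs fin by (intro measure_UNION_le) auto
  also have "\<dots> = h * card ?I" using h by simp
  finally show ?thesis .
qed

lemma card_cells_le_measure:
  fixes Z :: "real set"
  assumes h: "0 < h" and Z: "Z \<in> lmeasurable" and K: "finite K"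
    and sub: "\<And>k. k \<in> K \<Longrightarrow> {p + h * of_int k ..< p + h * of_int k + h} \<subseteq> Z"
  shows "h * card K \<le> measure lebesgue Z"
proof -
  let ?c = "\<lambda>i::int. {p + h * of_int i ..< p + h * of_int i + h}"
  have disj: "disjoint_family_on ?c K"
  proof (unfold disjoint_family_on_def, intro ballI impI)
    fix i j :: int assume "i \<noteq> j"
    then have "i + 1 \<le> j \<or> j + 1 \<le> i" by linarith
    then have "of_int i + (1::real) \<le> of_int j \<or> of_int j + (1::real) \<le> of_int i" by linarith
    then have "h * (of_int i + 1) \<le> h * of_int j \<or> h * (of_int j + 1) \<le> h * of_int i"
      using h by (metis mult_left_mono less_imp_le)
    then show "?c i \<inter> ?c j = {}" by (auto simp: algebra_simps)
  qed
  have "h * card K = (\<Sum>k\<in>K. measure lebesgue (?c k))" using h by simp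
  also have "\<dots> = measure lebesgue (\<Union>k\<in>K. ?c k)"
    using disj K h by (intro measure_finite_Union[symmetric]) auto
  also have "\<dots> \<le> measure lebesgue Z"
    using sub Z K by (intro measure_mono_fmeasurable) auto
  finally show ?thesis .
qed

text \<open>Representatives of \<open>X + Y\<close> modulo \<open>d\<close>. In the uses below all
  sums lie in [z, z + 2d], so subtracting \<open>d\<close> at most once suffices. Both ends of the
  interval are kept, although they are one point of the circle, to preserve compactness.\<close>

definition folded_sums :: "real \<Rightarrow> real \<Rightarrow> real set \<Rightarrow> real set \<Rightarrow> real set" where
  "folded_sums z d X Y = {t \<in> {z..z + d}. \<exists>x\<in>X. \<exists>y\<in>Y. t = x + y \<or> t + d = x + y}"

text \<open>Cut both circles into \<^term>\<open>P\<close> cells of length \<^term>\<open>h\<close>, \<^term>\<open>P\<close> prime, and apply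
  Cauchy--Davenport to the occupied cells. One cell is lost in Cauchy--Davenport and one more at the
  seam of the circle, since \<^term>\<open>Z\<close> is only a neighbourhood on the line.\<close>

lemma folded_sums_discrete:
  fixes X Y :: "real set" and P :: int
  assumes P: "prime P" and h: "0 < h"
    and X: "X \<in> lmeasurable" "X \<subseteq> {p..p + h * of_int P}" "p \<in> X"
    and Y: "Y \<in> lmeasurable" "Y \<subseteq> {q..q + h * of_int P}" "q \<in> Y"
    and d: "d = h * of_int P"
    and Z: "Z \<in> lmeasurable" "\<And>s t. s \<in> {p + q..p + q + d} \<Longrightarrow> t \<in> folded_sums (p + q) d X Y \<Longrightarrow> \<bar>s - t\<bar> \<le> 2 * h \<Longrightarrow> s \<in> Z"
  shows "min d (measure lebesgue X + measure lebesgue Y) - 2 * h \<le> measure lebesgue Z"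
proof -
  define I where "I X p = {i \<in> {0..<P}. \<exists>x\<in>X. p + h * of_int i \<le> x \<and> x < p + h * of_int i + h}" for X :: "real set" and p
  have P1: "P > 1" using P by (simp add: prime_gt_1_int)
  have "0 \<in> I X p" "0 \<in> I Y q" using X Y h P1 by (auto simp: I_def intro!: bexI)
  then have ne: "I X p \<noteq> {}" "I Y q \<noteq> {}" by auto
  have sub: "I X p \<subseteq> {0..<P}" "I Y q \<subseteq> {0..<P}" by (auto simp: I_def)
  have fin: "finite (I X p)" "finite (I Y q)" using sub finite_subset by blast+
  define S where "S = {(a + b) mod P | a b. a \<in> I X p \<and> b \<in> I Y q}"
  have S: "S \<subseteq> {0..<P}" using P1 by (auto simp: S_def)
  then have fS: "finite S" using finite_subset by blast
  have CD: "min (nat P) (card (I X p) + card (I Y q) - 1) \<le> card S"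
    unfolding S_def by (rule cauchy_davenport[OF P sub(1) ne(1) sub(2) ne(2)])
  have "card (I X p) \<ge> 1" using ne fin by (simp add: Suc_le_eq card_gt_0_iff)
  then have CD': "min (of_int P) (real (card (I X p)) + real (card (I Y q)) - 1) \<le> real (card S)"
    using CD P1 by (auto simp: min_def split: if_splits)
  have mX: "measure lebesgue X \<le> h * card (I X p)" unfolding I_def by (rule measure_le_card_cells[OF h X(1,2)])
  have mY: "measure lebesgue Y \<le> h * card (I Y q)" unfolding I_def by (rule measure_le_card_cells[OF h Y(1,2)])
  have "h * min (of_int P) (real (card (I X p)) + real (card (I Y q)) - 1) \<le> h * real (card S)"
    using CD' h by (intro mult_left_mono) auto
  moreover have "h * min (of_int P) (real (card (I X p)) + real (card (I Y q)) - 1)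
      = min d (h * real (card (I X p)) + h * real (card (I Y q)) - h)"
    using h d by (simp add: min_mult_distrib_left algebra_simps)
  ultimately have 1: "min d (measure lebesgue X + measure lebesgue Y - h) \<le> h * real (card S)"
    using mX mY by linarith
  \<comment> \<open>The representative \<open>t\<close> found below lies less than
    \<open>2 * h\<close> above the left end of cell \<open>k\<close>; for the last cell it could run
    past the end of the interval.\<close>
  define K where "K = S - {P - 1}"
  have "card S \<le> card K + 1" using diff_card_le_card_Diff[of "{P - 1}" S] by (simp add: K_def)
  then have "real (card S) \<le> real (card K) + 1" by linarith
  then have 2: "h * real (card S) \<le> h * real (card K) + h" using h
    by (metis mult_left_mono less_imp_le distrib_left mult.right_neutral)
  have "h * card K \<le> measure lebesgue Z"
  proof (rule card_cells_le_measure[OF h Z(1), where p = "p + q"])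
    show "finite K" using fS by (simp add: K_def)
    fix k assume k: "k \<in> K"
    then obtain i j where ij: "i \<in> I X p" "j \<in> I Y q" "k = (i + j) mod P" by (auto simp: K_def S_def)
    have kP: "0 \<le> k" "k \<le> P - 2" using k S by (force simp: K_def)+
    obtain x where x: "x \<in> X" "p + h * of_int i \<le> x" "x < p + h * of_int i + h" using ij by (auto simp: I_def)
    obtain y where y: "y \<in> Y" "q + h * of_int j \<le> y" "y < q + h * of_int j + h" using ij by (auto simp: I_def)
    have rng: "0 \<le> i" "i < P" "0 \<le> j" "j < P" using ij sub by force+
    have kk: "i + j = k \<or> i + j = k + P"
    proof (cases "i + j < P")
      case True
      then show ?thesis using ij rng by simp
    next
      case False
      have "(i + j) mod P = (i + j - P) mod P" by simp
      also have "\<dots> = i + j - P" using False rng by (intro mod_pos_pos_trivial) auto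
      finally show ?thesis using ij by linarith
    qed
    define t where "t = (if i + j = k then x + y else x + y - d)"
    have hij: "h * of_int i + h * of_int j = h * of_int k + (if i + j = k then 0 else d)"
    proof (cases "i + j = k")
      case True then show ?thesis by (simp flip: distrib_left of_int_add)
    next
      case False then show ?thesis using kk d by (simp flip: distrib_left of_int_add)
    qed
    then have t: "p + q + h * of_int k \<le> t" "t < p + q + h * of_int k + 2 * h"
      using x y by (auto simp: t_def split: if_splits)
    have hk: "0 \<le> h * of_int k" "h * of_int k \<le> d - 2 * h"
    proof -
      show "0 \<le> h * of_int k" using h kP by simp
      have "h * of_int k \<le> h * of_int (P - 2)" using h kP by (intro mult_left_mono) auto
      then show "h * of_int k \<le> d - 2 * h" using d by (simp add: algebra_simps)
    qed
    have tF: "t \<in> folded_sums (p + q) d X Y"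
      unfolding folded_sums_def using t hk x y by (auto simp: t_def split: if_splits)
    show "{p + q + h * of_int k ..< p + q + h * of_int k + h} \<subseteq> Z"
    proof
      fix s assume s: "s \<in> {p + q + h * of_int k ..< p + q + h * of_int k + h}"
      then have "\<bar>s - t\<bar> \<le> 2 * h" using t h by auto
      moreover have "s \<in> {p + q..p + q + d}" using s hk h by auto
      ultimately show "s \<in> Z" using Z(2) tF by blast
    qed
  qed
  then show ?thesis using 1 2 h by linarith
qed

lemma folded_sums_compact:
  assumes "compact X" "compact Y"
  shows "compact (folded_sums z d X Y)"
proof -
  let ?E = "{x + y | x y. x \<in> X \<and> y \<in> Y}"
  have E: "compact ?E" using assms by (rule compact_sums)
  have "folded_sums z d X Y = (?E \<inter> {z..z + d}) \<union> ((\<lambda>t. t - d) ` ?E \<inter> {z..z + d})"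
  proof (rule set_eqI)
    fix t
    have "t \<in> (\<lambda>t. t - d) ` ?E \<longleftrightarrow> t + d \<in> ?E"
      by (force simp: image_iff algebra_simps)
    then show "t \<in> folded_sums z d X Y \<longleftrightarrow> t \<in> (?E \<inter> {z..z + d}) \<union> ((\<lambda>t. t - d) ` ?E \<inter> {z..z + d})"
      by (auto simp: folded_sums_def)
  qed
  then show ?thesis
    using E by (simp add: compact_Un compact_Int compact_translation_subtract)
qed

text \<open>The discrete bound applies to closed neighbourhoods of the folded sumset with an error
  that vanishes with the cell length. They decrease to the compact set itself, so continuity from
  above gives the limit.\<close>

lemma folded_sums_measure:
  fixes X Y :: "real set"
  assumes d: "0 < d"
    and X: "compact X" "X \<subseteq> {p..p + d}" "p \<in> X"
    and Y: "compact Y" "Y \<subseteq> {q..q + d}" "q \<in> Y"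
  shows "min d (measure lebesgue X + measure lebesgue Y) \<le> measure lebesgue (folded_sums (p + q) d X Y)"
proof -
  let ?F = "folded_sums (p + q) d X Y"
  let ?m = "min d (measure lebesgue X + measure lebesgue Y)"
  have F: "compact ?F" using X Y by (intro folded_sums_compact)
  have Fne: "?F \<noteq> {}" using X Y d by (auto simp: folded_sums_def intro!: exI[of _ "p + q"])
  define N where "N n = {s \<in> {p + q..p + q + d}. infdist s ?F \<le> 2 * d / real (Suc n)}" for n
  have Nc: "compact (N n)" for n
  proof -
    have "N n = {p + q..p + q + d} \<inter> (\<lambda>s. infdist s ?F) -` {..2 * d / real (Suc n)}"
      by (auto simp: N_def)
    moreover have "closed ((\<lambda>s. infdist s ?F) -` {..2 * d / real (Suc n)})"
      by (intro closed_vimage continuous_intros)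
    ultimately show ?thesis by (simp add: compact_Int_closed)
  qed
  have lower: "?m - 2 * d / real (Suc n) \<le> measure lebesgue (N n)" for n
  proof -
    obtain P :: nat where P: "prime P" "Suc n < P" using bigger_prime by blast
    define h where "h = d / real P"
    have P0: "real P > 0" using P by simp
    have h: "0 < h" "d = h * of_int (int P)" using d P0 by (simp_all add: h_def)
    have hle: "2 * h \<le> 2 * d / real (Suc n)"
      unfolding h_def using P d by (simp add: divide_left_mono)
    have "?m - 2 * h \<le> measure lebesgue (N n)"
    proof (rule folded_sums_discrete[where P = "int P" and d = d and p = p and q = q])
      show "s \<in> N n" if "s \<in> {p + q..p + q + d}" "t \<in> ?F" "\<bar>s - t\<bar> \<le> 2 * h" for s t
      proof -
        have "infdist s ?F \<le> dist s t" using that by (intro infdist_le)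
        then show ?thesis using that hle by (auto simp: N_def dist_real_def)
      qed
    qed (use P h X Y Nc in \<open>auto simp: lmeasurable_compact\<close>)
    then show ?thesis using hle by linarith
  qed
  have dec: "decseq N"
  proof (rule decseq_SucI)
    fix n
    have "2 * d / real (Suc (Suc n)) \<le> 2 * d / real (Suc n)" using d by (intro divide_left_mono) auto
    then show "N (Suc n) \<le> N n" unfolding N_def by force
  qed
  have lim: "(\<lambda>n. 2 * d / real (Suc n)) \<longlonglongrightarrow> 0"
    using LIMSEQ_inverse_real_of_nat[THEN tendsto_mult_right_zero[of _ _ "2 * d"]] by (simp add: divide_inverse)
  have INT: "(\<Inter>n. N n) = ?F"
  proof (intro subset_antisym subsetI)
    fix s assume s: "s \<in> (\<Inter>n. N n)"
    then have "infdist s ?F \<le> 2 * d / real (Suc n)" for n by (simp add: N_def)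
    then have "infdist s ?F \<le> 0" using lim by (intro LIMSEQ_le_const[OF lim]) auto
    then have "infdist s ?F = 0" using infdist_nonneg[of s ?F] by linarith
    then show "s \<in> ?F" using F Fne by (simp add: in_closed_iff_infdist_zero compact_imp_closed)
  next
    fix s assume s: "s \<in> ?F"
    then have "s \<in> {p + q..p + q + d}" by (simp add: folded_sums_def)
    moreover have "infdist s ?F = 0" using s by simp
    ultimately show "s \<in> (\<Inter>n. N n)" using d by (simp add: N_def)
  qed
  have "(\<lambda>n. measure lebesgue (N n)) \<longlonglongrightarrow> measure lebesgue (\<Inter>n. N n)"
  proof (rule Lim_measure_decseq[OF _ dec])
    show "range N \<subseteq> sets lebesgue" using Nc by (auto dest: lmeasurable_compact)
    show "emeasure lebesgue (N i) \<noteq> \<infinity>" for i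
      using fmeasurableD2[OF lmeasurable_compact[OF Nc]] by simp
  qed
  then have 1: "(\<lambda>n. measure lebesgue (N n)) \<longlonglongrightarrow> measure lebesgue ?F" by (simp add: INT)
  have 2: "(\<lambda>n. ?m - 2 * d / real (Suc n)) \<longlonglongrightarrow> ?m"
    using tendsto_diff[OF tendsto_const[of ?m] lim] by simp
  show ?thesis by (rule LIMSEQ_le[OF 2 1]) (use lower in blast)
qed

section \<open>Sumsets of compact sets on the line\<close>

text \<open>Cut the sumset at \<open>p + q + d\<close> and shift the upper piece down by
  \<open>d\<close>. The union of the two pieces is the folded sumset; their intersection contains
  \<open>p + Y\<close>, since both ends of the interval belong to \<open>X\<close>.\<close>

lemma sumset_measure:
  fixes X Y :: "real set"
  assumes X: "compact X" "X \<subseteq> {p..p + d}" "p \<in> X" "p + d \<in> X"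
    and Y: "compact Y" "Y \<subseteq> {q..q + d}" "q \<in> Y"
  shows "measure lebesgue Y + min d (measure lebesgue X + measure lebesgue Y)
    \<le> measure lebesgue {x + y | x y. x \<in> X \<and> y \<in> Y}"
proof (cases "d = 0")
  case True
  then have "Y = {q}" using Y by auto
  then show ?thesis using True by simp
next
  case False
  then have d: "0 < d" using X by force
  let ?E = "{x + y | x y. x \<in> X \<and> y \<in> Y}"
  define E1 where "E1 = ?E \<inter> {p + q..p + q + d}"
  define E2 where "E2 = ?E \<inter> {p + q + d..p + q + 2 * d}"
  define G where "G = (\<lambda>t. t - d) ` E2"
  have E: "compact ?E" using X(1) Y(1) by (rule compact_sums)
  have c: "compact E1" "compact E2" "compact G"
    using E by (auto simp: E1_def E2_def G_def intro!: compact_Int compact_translation_subtract)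
  have lm: "E1 \<in> lmeasurable" "E2 \<in> lmeasurable" "G \<in> lmeasurable" "?E \<in> lmeasurable"
    using c E lmeasurable_compact by blast+
  have "?E = E1 \<union> E2" using X(2) Y(2) by (force simp: E1_def E2_def)
  then have "measure lebesgue ?E = measure lebesgue (E1 \<union> E2)" by (rule arg_cong)
  also have "\<dots> = measure lebesgue E1 + measure lebesgue E2 - measure lebesgue (E1 \<inter> E2)"
    using measure_Un3[OF lm(1,2)] .
  also have "measure lebesgue (E1 \<inter> E2) = 0"
  proof -
    have "measure lebesgue (E1 \<inter> E2) \<le> measure lebesgue {p + q + d}"
    proof (rule measure_mono_fmeasurable)
      show "E1 \<inter> E2 \<subseteq> {p + q + d}" by (auto simp: E1_def E2_def)
    qed (use lm in \<open>auto simp: lmeasurable_compact\<close>)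
    then show ?thesis by (simp add: measure_le_0_iff)
  qed
  also have "measure lebesgue E2 = measure lebesgue G" by (simp add: G_def measure_translation_subtract)
  finally have 1: "measure lebesgue ?E = measure lebesgue (E1 \<union> G) + measure lebesgue (E1 \<inter> G)"
    using measure_Un3[OF lm(1,3)] by simp
  have Gi: "t \<in> G \<longleftrightarrow> t + d \<in> E2" for t
    by (force simp: G_def image_iff algebra_simps)
  have "measure lebesgue Y = measure lebesgue ((+) p ` Y)" by (simp add: measure_translation)
  also have "\<dots> \<le> measure lebesgue (E1 \<inter> G)"
  proof (rule measure_mono_fmeasurable)
    show "(+) p ` Y \<subseteq> E1 \<inter> G"
    proof
      fix t assume "t \<in> (+) p ` Y"
      then obtain y where y: "y \<in> Y" "t = p + y" by blast
      have "t \<in> ?E" using y X by blast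
      moreover have "t + d \<in> ?E"
      proof -
        have "t + d = (p + d) + y" using y by simp
        then show ?thesis using y X by blast
      qed
      moreover have "t \<in> {p + q..p + q + d}" using y Y by auto
      ultimately show "t \<in> E1 \<inter> G" by (auto simp: E1_def E2_def Gi)
    qed
    show "(+) p ` Y \<in> sets lebesgue"
      using Y by (intro fmeasurableD lmeasurable_compact compact_translation)
    show "E1 \<inter> G \<in> lmeasurable" using lm by blast
  qed
  finally have 2: "measure lebesgue Y \<le> measure lebesgue (E1 \<inter> G)" .
  have "folded_sums (p + q) d X Y = E1 \<union> G"
  proof (rule set_eqI)
    fix t show "t \<in> folded_sums (p + q) d X Y \<longleftrightarrow> t \<in> E1 \<union> G"
      unfolding Un_iff Gi by (auto simp: folded_sums_def E1_def E2_def)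
  qed
  then have "min d (measure lebesgue X + measure lebesgue Y) \<le> measure lebesgue (E1 \<union> G)"
    using folded_sums_measure[OF d X(1-3) Y] by simp
  then show ?thesis using 1 2 by linarith
qed

subsection \<open>Mass of 3-sum-free sets on intervals\<close>

definition mass :: "real set \<Rightarrow> real \<Rightarrow> real \<Rightarrow> real" where
  "mass A l u = measure lebesgue (A \<inter> {l..u})"

lemma mass_nonneg: "0 \<le> mass A l u"
  by (simp add: mass_def)

lemma lmeasurable_compact_Int_Icc:
  fixes A :: "real set"
  assumes "compact A"
  shows "A \<inter> {l..u} \<in> lmeasurable"
  using assms by (intro lmeasurable_compact compact_Int) auto

lemma mass_mono:
  assumes "compact A" "l' \<le> l" "u \<le> u'"
  shows "mass A l u \<le> mass A l' u'"
  unfolding mass_def using assms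
  by (intro measure_mono_fmeasurable fmeasurableD lmeasurable_compact_Int_Icc) auto

lemma mass_le_length:
  assumes "compact A" "l \<le> u"
  shows "mass A l u \<le> u - l"
proof -
  have "mass A l u \<le> measure lebesgue {l..u}"
    unfolding mass_def using assms(1)
    by (intro measure_mono_fmeasurable fmeasurableD lmeasurable_compact_Int_Icc) auto
  then show ?thesis using assms by simp
qed

lemma mass_split:
  assumes "compact A"
  shows "mass A l u \<le> mass A l t + mass A t u"
proof -
  have "mass A l u \<le> measure lebesgue (A \<inter> {l..t} \<union> A \<inter> {t..u})"
    unfolding mass_def using assms
    by (intro measure_mono_fmeasurable fmeasurableD fmeasurable.Un lmeasurable_compact_Int_Icc) auto
  also have "\<dots> \<le> mass A l t + mass A t u"
    unfolding mass_def using assms by (intro measure_Un_le fmeasurableD lmeasurable_compact_Int_Icc)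
  finally show ?thesis .
qed

text \<open>Lets an interval start at an element of \<open>A\<close>, so that a translate by this
  element can be used to cover it.\<close>

lemma mass_least:
  assumes A: "compact A" and ne: "mass A l u \<noteq> 0"
  obtains x where "x \<in> A" "l \<le> x" "x \<le> u" "mass A l u = mass A x u"
proof -
  have c: "compact (A \<inter> {l..u})" using A by (simp add: compact_Int)
  have "A \<inter> {l..u} \<noteq> {}" using ne by (auto simp: mass_def)
  then obtain x where x: "x \<in> A \<inter> {l..u}" "\<And>y. y \<in> A \<inter> {l..u} \<Longrightarrow> x \<le> y"
    using compact_attains_inf[OF c] by blast
  have "A \<inter> {l..u} = A \<inter> {x..u}" using x by force
  then have "mass A l u = mass A x u" by (simp add: mass_def)
  with x(1) show ?thesis by (intro that) auto
qed

section \<open>Gaps forced by sums divided by three\<close>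

text \<open>The set (X + Y)/3 is disjoint from \<open>A\<close>, and both compete for room in
  [l, u].\<close>

lemma mass_add_sumset_le:
  assumes sf: "three_sum_free A" and A: "compact A"
    and X: "compact X" "X \<subseteq> A" and Y: "compact Y" "Y \<subseteq> A"
    and sub: "\<And>x y. x \<in> X \<Longrightarrow> y \<in> Y \<Longrightarrow> 3 * l \<le> x + y \<and> x + y \<le> 3 * u" and lu: "l \<le> u"
  shows "mass A l u + measure lebesgue {x + y | x y. x \<in> X \<and> y \<in> Y} / 3 \<le> u - l"
proof -
  let ?E = "{x + y | x y. x \<in> X \<and> y \<in> Y}"
  let ?T = "(\<lambda>t. (1 / 3) *\<^sub>R t + 0) ` ?E"
  have "compact ?E" using X(1) Y(1) by (rule compact_sums)
  then have "compact ?T" by (intro compact_continuous_image continuous_intros)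
  then have T: "?T \<in> lmeasurable" by (rule lmeasurable_compact)
  have AI: "A \<inter> {l..u} \<in> lmeasurable" using A by (rule lmeasurable_compact_Int_Icc)
  have "measure lebesgue ?T = measure lebesgue ?E / 3"
    using measure_lebesgue_affine[of "1 / 3" "0 :: real" ?E] by simp
  moreover have "measure lebesgue (A \<inter> {l..u} \<union> ?T) = measure lebesgue (A \<inter> {l..u}) + measure lebesgue ?T"
  proof (rule measure_Un2[OF AI T, THEN trans])
    have "t \<notin> A" if t: "t \<in> ?T" for t
    proof -
      obtain x y where "x \<in> X" "y \<in> Y" "x + y = 3 * t" using t by auto
      then show ?thesis using sf X(2) Y(2) unfolding three_sum_free_def by blast
    qed
    then have "?T - A \<inter> {l..u} = ?T" by blast
    then show "measure lebesgue (A \<inter> {l..u}) + measure lebesgue (?T - A \<inter> {l..u})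
        = measure lebesgue (A \<inter> {l..u}) + measure lebesgue ?T" by simp
  qed
  moreover have "measure lebesgue (A \<inter> {l..u} \<union> ?T) \<le> measure lebesgue {l..u}"
  proof (rule measure_mono_fmeasurable)
    have "?T \<subseteq> {l..u}"
    proof
      fix t assume "t \<in> ?T"
      then obtain x y where "x \<in> X" "y \<in> Y" "x + y = 3 * t" by auto
      then show "t \<in> {l..u}" using sub[of x y] by simp
    qed
    then show "A \<inter> {l..u} \<union> ?T \<subseteq> {l..u}" by blast
  qed (use AI T in auto)
  ultimately show ?thesis using lu by (simp add: mass_def)
qed

lemma mass_translate_le:
  assumes sf: "three_sum_free A" and A: "compact A" and x: "x \<in> A" and ce: "c \<le> e"
  shows "mass A ((x + c) / 3) ((x + e) / 3) \<le> (e - c - mass A c e) / 3"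
proof -
  let ?C = "A \<inter> {c..e}"
  have "mass A ((x + c) / 3) ((x + e) / 3) + measure lebesgue {a + y | a y. a \<in> {x} \<and> y \<in> ?C} / 3
      \<le> (x + e) / 3 - (x + c) / 3"
  proof (rule mass_add_sumset_le[OF sf A])
    show "compact ?C" using A by (simp add: compact_Int)
  qed (use x ce in auto)
  moreover have "{a + y | a y. a \<in> {x} \<and> y \<in> ?C} = (+) x ` ?C" by auto
  then have "measure lebesgue {a + y | a y. a \<in> {x} \<and> y \<in> ?C} = mass A c e"
    by (simp only: measure_translation mass_def)
  ultimately show ?thesis by argo
qed

lemma mass_self_sum_le:
  assumes sf: "three_sum_free A" and A: "compact A" "A \<subseteq> {m..b}" "m \<in> A" "b \<in> A"
  shows "3 * mass A (2 * m / 3) (2 * b / 3) + mass A m b + min (b - m) (mass A m b + mass A m b) \<le> 2 * (b - m)"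
proof -
  have "A \<inter> {m..b} = A" using A by blast
  then have eq: "measure lebesgue A = mass A m b" by (simp add: mass_def)
  have mb: "m \<le> b" using A by auto
  have "measure lebesgue A + min (b - m) (measure lebesgue A + measure lebesgue A)
      \<le> measure lebesgue {x + y | x y. x \<in> A \<and> y \<in> A}"
    using A by (intro sumset_measure[where p = m and q = m]) auto
  moreover have "mass A (2 * m / 3) (2 * b / 3) + measure lebesgue {x + y | x y. x \<in> A \<and> y \<in> A} / 3
      \<le> 2 * b / 3 - 2 * m / 3"
  proof (rule mass_add_sumset_le[OF sf A(1) A(1) order_refl A(1) order_refl])
    fix x y assume "x \<in> A" "y \<in> A"
    then have "x \<in> {m..b}" "y \<in> {m..b}" using A(2) by blast+
    then show "3 * (2 * m / 3) \<le> x + y \<and> x + y \<le> 3 * (2 * b / 3)" by simp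
  qed (use mb in simp)
  ultimately show ?thesis unfolding eq by argo
qed

text \<open>Below 2b/3 the sums \<open>A + A\<close> limit the mass; above, the length b/3 does. If
  the minimum in the self-sum bound is not \<open>b - m\<close>, then \<open>A\<close> has less than
  half of [m, b] and the claim is immediate.\<close>

lemma mass_crude_bound:
  assumes sf: "three_sum_free A" and A: "compact A" "A \<subseteq> {m..b}" "m \<in> A" "b \<in> A" and m: "0 \<le> m"
  shows "mass A m b \<le> b / 2 - m / 4"
proof -
  have mb: "m \<le> b" using A by auto
  have "mass A m b \<le> mass A m (2 * b / 3) + mass A (2 * b / 3) b" by (rule mass_split[OF A(1)])
  moreover have "mass A m (2 * b / 3) \<le> mass A (2 * m / 3) (2 * b / 3)"
    using m by (intro mass_mono[OF A(1)]) auto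
  moreover have "mass A (2 * b / 3) b \<le> b / 3" using mass_le_length[OF A(1), of "2 * b / 3" b] mb m by simp
  ultimately show ?thesis using mass_self_sum_le[OF sf A] m mb unfolding min_def by (simp split: if_splits; linarith)
qed

text \<open>In the proof, \<^term>\<open>\<eta>\<close> is the measure of the holes of the top part in \<^term>\<open>{c..b}\<close>. Every
  interval covered by a translate of the top part, or by its sumset with itself, carries mass at
  most \<^term>\<open>\<eta> / 3\<close>. The only delicate case is an element \<^term>\<open>x\<close> between \<^term>\<open>(m + b) / 3\<close> and
  \<^term>\<open>c / 2\<close>, where the translates by \<^term>\<open>m\<close> and \<^term>\<open>x\<close> leave a gap; there the sumset
  inequality is applied to all of \<^term>\<open>{m..x}\<close>, with deficit \<^term>\<open>e\<close>.\<close>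

lemma mass_recursion:
  assumes sf: "three_sum_free A" and A: "compact A" "A \<subseteq> {m..b}" "m \<in> A" "b \<in> A"
    and m: "0 \<le> m" "m \<le> b / 2" and large: "5 * b / 12 \<le> mass A m b + m / 3"
  shows "mass A m b \<le> b / 3 + mass A m (2 * b / 9 + m / 3)"
proof -
  have b: "0 \<le> b" using m by linarith
  note split = mass_split[OF A(1)] and len = mass_le_length[OF A(1)] and mono = mass_mono[OF A(1)]
  define a where "a = mass A m b"
  \<comment> \<open>\<open>c = b\<close> is the default for a null top part.\<close>
  obtain c where c: "c \<in> A" "2 * b / 3 \<le> c" "c \<le> b" "mass A (2 * b / 3) b = mass A c b"
  proof (cases "mass A (2 * b / 3) b = 0")
    case False
    then show ?thesis using mass_least[OF A(1)] that by metis
  next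
    case True
    have "mass A b b = 0" using len[of b b] mass_nonneg[of A b b] by simp
    then show ?thesis using True that[of b] A(4) b by simp
  qed
  define g where "g = mass A c b"
  define \<eta> where "\<eta> = b - c - g"
  have \<eta>0: "0 \<le> \<eta>" using len[OF c(3)] by (simp add: \<eta>_def g_def)
  have ag: "a \<le> mass A m (2 * b / 3) + g" using split[of m b "2 * b / 3"] c by (simp add: a_def g_def)
  \<comment> \<open>The hypothesis \<open>large\<close> is calibrated so that both branches of the
    minimum give b/6, one of them through \<open>m \<le> b / 2\<close>.\<close>
  have g6: "b / 6 \<le> g"
  proof -
    have "mass A m (2 * b / 3) \<le> mass A (2 * m / 3) (2 * b / 3)" using m by (intro mono) auto
    then show ?thesis
      using mass_self_sum_le[OF sf A] ag large m unfolding a_def[symmetric] min_def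
      by (simp split: if_splits; linarith)
  qed
  have cover: "mass A ((x + c) / 3) ((x + b) / 3) \<le> \<eta> / 3" if "x \<in> A" for x
    using mass_translate_le[OF sf A(1) that c(3)] by (simp add: \<eta>_def g_def)
  have cover': "mass A l u \<le> \<eta> / 3" if "x \<in> A" "(x + c) / 3 \<le> l" "u \<le> (x + b) / 3" for x l u
    using cover[OF that(1)] mono[OF that(2,3)] by linarith
  \<comment> \<open>Since b - c \<le> b/3 \<le> 2g, the minimum is b - c, so \<open>C + C\<close>
    misses at most \<eta> of its range.\<close>
  have CC: "mass A (2 * c / 3) (2 * b / 3) \<le> \<eta> / 3"
  proof -
    let ?C = "A \<inter> {c..b}"
    have C: "compact ?C" "?C \<subseteq> {c..b}" "c \<in> ?C" "b \<in> ?C" using A c by (auto simp: compact_Int)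
    have "measure lebesgue ?C + min (b - c) (measure lebesgue ?C + measure lebesgue ?C)
        \<le> measure lebesgue {x + y | x y. x \<in> ?C \<and> y \<in> ?C}"
      using C by (intro sumset_measure[where p = c and q = c]) auto
    moreover have "mass A (2 * c / 3) (2 * b / 3) + measure lebesgue {x + y | x y. x \<in> ?C \<and> y \<in> ?C} / 3
        \<le> 2 * b / 3 - 2 * c / 3"
      using C c by (intro mass_add_sumset_le[OF sf A(1)]) auto
    moreover have "b - c \<le> 2 * g" using g6 c by simp
    ultimately show ?thesis by (simp add: g_def mass_def \<eta>_def)
  qed
  have c56: "c \<le> 5 * b / 6" using \<eta>0 g6 by (simp add: \<eta>_def)
  define U where "U = mass A (4 * b / 9) (2 * b / 3)"
  have U1: "U \<le> 2 * c / 3 - 4 * b / 9 + \<eta> / 3"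
    unfolding U_def using split[of "4 * b / 9" "2 * b / 3" "2 * c / 3"] len[of "4 * b / 9" "2 * c / 3"] CC c by linarith
  \<comment> \<open>13b/27 is (4b/9 + b)/3: the translate by any \<open>u\<close> from 4b/9 on
    reaches at least this far, and it starts no later than \<open>u\<close> because c \<le> 5b/6.
    The condition on \<open>c\<close> says 13b/27 \<le> 2c/3.\<close>
  have U2: "U \<le> 2 * c / 3 - 13 * b / 27 + 2 * \<eta> / 3" if c13: "13 * b / 18 \<le> c"
  proof -
    have "mass A (4 * b / 9) (13 * b / 27) \<le> \<eta> / 3"
    proof (cases "mass A (4 * b / 9) (13 * b / 27) = 0")
      case False
      then obtain u where u: "u \<in> A" "4 * b / 9 \<le> u" "u \<le> 13 * b / 27"
        "mass A (4 * b / 9) (13 * b / 27) = mass A u (13 * b / 27)"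
        by (rule mass_least[OF A(1)])
      show ?thesis unfolding u(4) by (rule cover'[OF u(1)]) (use u c56 b in auto)
    qed (use \<eta>0 in simp)
    moreover have "mass A (13 * b / 27) (2 * c / 3) \<le> 2 * c / 3 - 13 * b / 27" using c13 by (intro len) simp
    moreover have "U \<le> mass A (4 * b / 9) (13 * b / 27) + mass A (13 * b / 27) (2 * b / 3)"
      unfolding U_def by (rule split)
    moreover have "mass A (13 * b / 27) (2 * b / 3) \<le> mass A (13 * b / 27) (2 * c / 3) + mass A (2 * c / 3) (2 * b / 3)"
      by (rule split)
    ultimately show ?thesis using CC by linarith
  qed
  \<comment> \<open>The cut is (m + 2b/3)/3, the lowest possible start of the translate by
    \<open>m\<close>.\<close>
  define L where "L = mass A m (2 * b / 9 + m / 3)"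
  have low: "mass A m ((m + c) / 3) \<le> L + (c - 2 * b / 3) / 3"
    unfolding L_def using split[of m "(m + c) / 3" "2 * b / 9 + m / 3"] 
      len[of "2 * b / 9 + m / 3" "(m + c) / 3"] c(2) by (simp add: field_simps)
  have mU: "mass A m (2 * b / 3) \<le> mass A m (4 * b / 9) + U" unfolding U_def by (rule split)
  have mlow: "mass A m (4 * b / 9) \<le> mass A m ((m + c) / 3) + mass A ((m + c) / 3) (4 * b / 9)" by (rule split)
  have first: "mass A ((m + c) / 3) ((m + b) / 3) \<le> \<eta> / 3" by (rule cover[OF A(3)])
  \<comment> \<open>The translate by any x \<ge> b/3 extends at least to 4b/9.\<close>
  define K where "K = mass A ((m + b) / 3) (4 * b / 9)"
  have mK: "mass A ((m + c) / 3) (4 * b / 9) \<le> \<eta> / 3 + K"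
    unfolding K_def using split[of "(m + c) / 3" "4 * b / 9" "(m + b) / 3"] first by linarith
  \<comment> \<open>Exact repayment: three terms \<eta>/3 occur, and L + (c - 2b/3) + \<eta> + g = L
    + b/3.\<close>
  have easy: "a \<le> b / 3 + L" if "K \<le> \<eta> / 3"
    using that ag mU mlow mK low U1 by (simp add: \<eta>_def field_simps)
  have "a \<le> b / 3 + L"
  proof (cases "K = 0")
    case True
    then show ?thesis using easy \<eta>0 by simp
  next
    case False
    then obtain x where x: "x \<in> A" "(m + b) / 3 \<le> x" "x \<le> 4 * b / 9" "K = mass A x (4 * b / 9)"
      unfolding K_def by (rule mass_least[OF A(1)])
    show ?thesis
    proof (cases "c / 2 \<le> x")
      case True
      have "K \<le> \<eta> / 3" unfolding x(4) by (rule cover'[OF x(1)]) (use True x m in auto)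
      then show ?thesis by (rule easy)
    next
      case False': False
      let ?X = "A \<inter> {m..x}" and ?C = "A \<inter> {c..b}"
      define e where "e = x - m - min (x - m) (mass A m x + g)"
      have xm: "m \<le> x" using A(2) x(1) by auto
      \<comment> \<open>The top part is short enough for the sumset inequality: c > 2x and 3x \<ge>
        m + b give b - c < x - m.\<close>
      have "g + min (x - m) (mass A m x + g) \<le> measure lebesgue {s + y | s y. s \<in> ?X \<and> y \<in> ?C}"
        unfolding g_def mass_def using A x xm c False' by (intro sumset_measure[where p = m and q = c]) (auto simp: compact_Int)
      moreover have "mass A ((m + c) / 3) ((x + b) / 3) + measure lebesgue {s + y | s y. s \<in> ?X \<and> y \<in> ?C} / 3
          \<le> (x + b) / 3 - (m + c) / 3"
        using A x xm c by (intro mass_add_sumset_le[OF sf A(1)]) (auto simp: compact_Int)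
      ultimately have mid0: "mass A ((m + c) / 3) ((x + b) / 3) \<le> (\<eta> + e) / 3"
        unfolding e_def \<eta>_def by argo
      have mid: "mass A ((m + c) / 3) (4 * b / 9) \<le> (\<eta> + e) / 3"
        using mid0 mono[of "(m + c) / 3" "(m + c) / 3" "4 * b / 9" "(x + b) / 3"] x m by simp
      have up: "mass A x (4 * b / 9) \<le> (c - 2 * x) / 3 + \<eta> / 3"
      proof -
        have "mass A ((x + c) / 3) (4 * b / 9) \<le> \<eta> / 3" by (rule cover'[OF x(1)]) (use x m in auto)
        moreover have "mass A x ((x + c) / 3) \<le> (x + c) / 3 - x" using False' by (intro len) simp
        ultimately show ?thesis using split[of x "4 * b / 9" "(x + c) / 3"] by (simp add: field_simps)
      qed
      have tot: "a \<le> mass A m x + mass A x (4 * b / 9) + U + g"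
        using ag mU split[of m "4 * b / 9" x] by linarith
      \<comment> \<open>This is exactly what remains after inserting \<open>low\<close> and
        \<open>mid\<close> into the bound for \<open>a\<close>.\<close>
      have "U + e / 3 \<le> 2 * (b / 3 - g) / 3"
      proof (cases "e = 0")
        case True
        then show ?thesis using U1 \<eta>0 by (simp add: \<eta>_def field_simps)
      next
        case ne: False
        then have "e = x - m - mass A m x - g" by (auto simp: e_def min_def split: if_splits)
        \<comment> \<open>A nonzero deficit means that \<open>A\<close> is thin on [m, x], so the
          largeness of \<open>a\<close> bounds \<open>e\<close>. For small \<open>c\<close> the
          estimate \<open>U1\<close> then suffices; otherwise \<open>U2\<close> is used.\<close>
        then have e: "e \<le> x - m - a + U + (c - 2 * x) / 3 + \<eta> / 3" using tot up by linarith
        show ?thesis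
        proof (cases "13 * b / 18 \<le> c")
          case True
          then show ?thesis using U2[OF True] e g6 c56 large False' \<eta>0 m unfolding a_def[symmetric] \<eta>_def by argo
        next
          case False
          then show ?thesis using U1 e g6 large False' \<eta>0 m unfolding a_def[symmetric] \<eta>_def by argo
        qed
      qed
      then show ?thesis using ag mU mlow mid low unfolding \<eta>_def by argo
    qed
  qed
  then show ?thesis by (simp add: a_def L_def)
qed

section \<open>Iterating the recursion\<close>

text \<open>The recursion cuts at a point that need not belong to \<open>A\<close>, whereas the
  bounds require the right end to be an element; hence the retreat to the last element
  \<open>v\<close>.\<close>

lemma initial_segment:
  assumes sf: "three_sum_free A" and A: "compact A" "m \<in> A" and r: "m \<le> r"
  obtains v B where "three_sum_free B" "compact B" "B \<subseteq> {m..v}" "m \<in> B" "v \<in> B" "v \<le> r" "mass A m r = mass B m v"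
proof -
  define B where "B = A \<inter> {m..r}"
  have cB: "compact B" unfolding B_def using A(1) by (intro compact_Int) auto
  have mB: "m \<in> B" using A(2) r by (simp add: B_def)
  then obtain v where v: "v \<in> B" "\<And>y. y \<in> B \<Longrightarrow> y \<le> v"
    using compact_attains_sup[OF cB] by blast
  have sfB: "three_sum_free B" using sf unfolding three_sum_free_def B_def by blast
  have Bv: "B \<subseteq> {m..v}"
  proof
    fix y assume "y \<in> B"
    then show "y \<in> {m..v}" using v(2)[of y] by (simp add: B_def)
  qed
  then have "B \<inter> {m..v} = B" by blast
  then have "mass A m r = mass B m v" unfolding mass_def B_def[symmetric] by simp
  moreover have "v \<le> r" using v(1) by (simp add: B_def)
  ultimately show ?thesis using that[OF sfB cB Bv mB v(1)] by blast
qed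

text \<open>After one recursion the rest is at most its length 2b/9 - 2m/3 and, by the crude bound,
  at most b/9 - m/12. These agree at m = 4b/21, where the total is 3b/7. The claim is the multiple
  of b - m/3 with this value there; its slope in \<open>m\<close> lies between those of the two
  bounds.\<close>

lemma mass_bound_least:
  assumes sf: "three_sum_free A" and A: "compact A" "A \<subseteq> {m..b}" "m \<in> A" "b \<in> A" and m: "0 \<le> m"
  shows "mass A m b \<le> 27 / 59 * b - 9 / 59 * m"
proof (rule ccontr)
  assume "\<not> ?thesis"
  then have big: "27 / 59 * b - 9 / 59 * m < mass A m b" by simp
  have mb: "m \<le> b" using A by auto
  have crude: "mass A m b \<le> b / 2 - m / 4" by (rule mass_crude_bound[OF sf A m])
  have m2: "m \<le> b / 2" using big crude mb m by linarith
  have "5 * b / 12 \<le> mass A m b + m / 3" using big m2 m by linarith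
  then have rec: "mass A m b \<le> b / 3 + mass A m (2 * b / 9 + m / 3)"
    by (rule mass_recursion[OF sf A m m2])
  show False
  proof (cases "m \<le> 2 * b / 9 + m / 3")
    \<comment> \<open>Here m > b/3, nothing is left below the cut, and the recursion gives only
      b/3.\<close>
    case False
    then have "mass A m (2 * b / 9 + m / 3) = 0" by (simp add: mass_def)
    then show False using rec big m2 m by linarith
  next
    case True
    have 1: "mass A m (2 * b / 9 + m / 3) \<le> 2 * b / 9 + m / 3 - m" using True by (rule mass_le_length[OF A(1)])
    obtain v B where vB: "three_sum_free B" "compact B" "B \<subseteq> {m..v}" "m \<in> B" "v \<in> B" "v \<le> 2 * b / 9 + m / 3" "mass A m (2 * b / 9 + m / 3) = mass B m v"
      by (rule initial_segment[OF sf A(1,3) True])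
    have "mass B m v \<le> v / 2 - m / 4" by (rule mass_crude_bound[OF vB(1-5) m])
    then have "mass A m (2 * b / 9 + m / 3) \<le> b / 9 - m / 12" using vB(6,7) by linarith
    then show False using 1 rec big by linarith
  qed
qed

text \<open>With v \<le> 2b/9 + m/3 the terms in \<open>m\<close> cancel in the previous bound,
  leaving 6b/59, and 1/3 + 6/59 = 77/177.\<close>

lemma mass_bound:
  assumes sf: "three_sum_free A" and A: "compact A" "A \<subseteq> {m..b}" "m \<in> A" "b \<in> A" and m: "0 \<le> m"
  shows "mass A m b \<le> 77 / 177 * b"
proof (rule ccontr)
  assume "\<not> ?thesis"
  then have big: "77 / 177 * b < mass A m b" by simp
  have mb: "m \<le> b" using A by auto
  have crude: "mass A m b \<le> b / 2 - m / 4" by (rule mass_crude_bound[OF sf A m])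
  have m2: "m \<le> b / 2" using big crude mb m by linarith
  have "5 * b / 12 \<le> mass A m b + m / 3" using big m2 m by linarith
  then have rec: "mass A m b \<le> b / 3 + mass A m (2 * b / 9 + m / 3)"
    by (rule mass_recursion[OF sf A m m2])
  show False
  proof (cases "m \<le> 2 * b / 9 + m / 3")
    case False
    then have "mass A m (2 * b / 9 + m / 3) = 0" by (simp add: mass_def)
    then show False using rec big m2 m by linarith
  next
    case True
    obtain v B where vB: "three_sum_free B" "compact B" "B \<subseteq> {m..v}" "m \<in> B" "v \<in> B" "v \<le> 2 * b / 9 + m / 3" "mass A m (2 * b / 9 + m / 3) = mass B m v"
      by (rule initial_segment[OF sf A(1,3) True])
    have "mass B m v \<le> 27 / 59 * v - 9 / 59 * m" by (rule mass_bound_least[OF vB(1-5) m])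
    then show False using vB(6,7) rec big by linarith
  qed
qed

theorem theorem1p1:
  fixes A :: "real set"
  assumes "A \<in> sets lebesgue"
    and "A \<subseteq> {0..1}"
    and "three_sum_free A"
  shows "measure lebesgue A \<le> 77 / 177"
proof (rule field_le_epsilon)
  fix \<epsilon> :: real assume "0 < \<epsilon>"
  have bA: "bounded A" using assms(2) bounded_subset bounded_closed_interval by blast
  then have lA: "A \<in> lmeasurable" using assms(1) by (rule bounded_set_imp_lmeasurable)
  \<comment> \<open>Inner regularity reduces to a compact subset, which inherits 3-sum-freeness and
    attains its extremes.\<close>
  obtain T where T: "closed T" "T \<subseteq> A" "A - T \<in> lmeasurable" "emeasure lebesgue (A - T) < ennreal \<epsilon>"
    using sets_lebesgue_inner_closed[OF assms(1) \<open>0 < \<epsilon>\<close>] by blast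
  have cT: "compact T" using T(1,2) bA bounded_subset compact_eq_bounded_closed by blast
  have "measure lebesgue (A - T) < \<epsilon>"
    using T(3,4) \<open>0 < \<epsilon>\<close> by (simp add: emeasure_eq_measure2 ennreal_less_iff)
  moreover have "measure lebesgue A \<le> measure lebesgue T + measure lebesgue (A - T)"
    using measure_Un_le[of T lebesgue "A - T"] T(2,3) lmeasurable_compact[OF cT]
    by (simp add: Un_absorb1 fmeasurableD)
  moreover have "measure lebesgue T \<le> 77 / 177"
  proof (cases "T = {}")
    case False
    obtain m where m: "m \<in> T" "\<And>t. t \<in> T \<Longrightarrow> m \<le> t" using compact_attains_inf[OF cT False] by blast
    obtain b where b: "b \<in> T" "\<And>t. t \<in> T \<Longrightarrow> t \<le> b" using compact_attains_sup[OF cT False] by blast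
    have sub: "T \<subseteq> {m..b}" using m b by auto
    then have "T \<inter> {m..b} = T" by blast
    moreover have "three_sum_free T" using assms(3) T(2) unfolding three_sum_free_def by blast
    moreover have "0 \<le> m" "b \<le> 1" using m b T(2) assms(2) by auto
    ultimately show ?thesis using mass_bound[of T m b] cT sub m b by (simp add: mass_def)
  qed simp
  ultimately show "measure lebesgue A \<le> 77 / 177 + \<epsilon>" by linarith
qed

end
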